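(* Consider a two-dimensional topological field theory with physical operators $\mathcal{O}_\alpha$ $(\alpha=0,\dots,K)$, perturbed by adding to its action a term $\delta S$ which, for a given triangulation, has the local form $$\delta S=\sum_\alpha\sum_x f_\alpha(n_x)\,\mathcal{O}_\alpha,$$ where $x$ runs over the vertices of the triangulation and $n_x$ is the number of triangles around the vertex $x$. If $\exp(-\delta S)$ is invariant under fusion and bubble transformations of the triangulation, then each $f_\alpha$ has the form $$f_\alpha(n_x)=A_\alpha\,(n_x-6)$$ with a constant $A_\alpha$; that is, $f_\alpha(n_x)$ is proportional to the deficit angle around the vertex $x$.
   Context: The physical operators $\mathcal{O}_\alpha$ of a topological field theory correspond to a basis $\phi_\alpha$ of a finite-dimensional commutative algebra; they multiply in correlation functions according to the product of that algebra, and their insertions do not depend on location. Perturbed correlation functions are obtained by inserting $\exp(-\delta S)$ into the original ones: $\langle\cdots\rangle'=\langle\cdots e^{-\delta S}\rangle$. Fusion transformation: two triangles sharing an edge $xz$ and forming a quadrilateral with successive vertices $x,y,z,w$ are replaced by the two triangles sharing the other diagonal $yw$; thus $n_x,n_y,n_z,n_w$ become $n_x-1,\,n_y+1,\,n_z-1,\,n_w+1$. Bubble transformation (and its inverse): an edge with end points $x,y$ is opened to a bigon, which is filled by two triangles sharing a new interior vertex; thus $n_x,n_y$ become $n_x+2,\,n_y+2$ and a new vertex with exactly $2$ triangles around it is created.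
   Formalization: As stated the claim fails because exp is periodic (e.g. O_0=1, f_0(n)=2πi for n=3 and 0 otherwise); the formal version also assumes that f is reached from 0 by a continuous family of couplings with exp(-δS) invariant throughout. *)

theory Defs
  imports "HOL-Analysis.Analysis" "HOL-Combinatorics.Orbits" "HOL-Combinatorics.Permutations"
begin

text \<open>
  A triangulation of a closed connected oriented surface, as a combinatorial map.  A dart is a side
  of a triangle, directed along the boundary orientation of that triangle: \<open>nxt\<close> is the following
  side of the same triangle, and \<open>opp\<close> is the side, of the same or of another triangle, to which it
  is glued with reversed direction.  As the bubble transformation demands, triangles may share
  several edges and vertices (a vertex may have only two, or even one, triangle around it).
\<close>

record tri_map =
  darts :: "nat set"
  opp :: "nat \<Rightarrow> nat"
  nxt :: "nat \<Rightarrow> nat"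

definition triangulation :: "tri_map \<Rightarrow> bool" where
  "triangulation T \<longleftrightarrow>
     finite (darts T) \<and> darts T \<noteq> {} \<and>
     opp T permutes darts T \<and> nxt T permutes darts T \<and>
     (\<forall>d\<in>darts T. opp T d \<noteq> d \<and> opp T (opp T d) = d) \<and>
     (\<forall>d\<in>darts T. nxt T d \<noteq> d \<and> nxt T (nxt T (nxt T d)) = d) \<and>
     (\<forall>d\<in>darts T. \<forall>d'\<in>darts T.
        (d, d') \<in> ({(a, opp T a) | a. a \<in> darts T} \<union> {(a, nxt T a) | a. a \<in> darts T})\<^sup>*)"

text \<open>
  \<open>nxt T (nxt T d)\<close> ends where \<open>d\<close> starts, so \<open>rot T\<close> permutes the darts with a given initial
  vertex cyclically; a vertex is identified with the set of darts starting there.  Each triangle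
  corner at the vertex contains exactly one such dart, hence \<open>card x\<close> is the number of triangles
  around \<open>x\<close>, a triangle being counted once for each of its corners at \<open>x\<close>.
\<close>

definition rot :: "tri_map \<Rightarrow> nat \<Rightarrow> nat" where
  "rot T d = opp T (nxt T (nxt T d))"

definition vertices :: "tri_map \<Rightarrow> nat set set" where
  "vertices T = orbit (rot T) ` darts T"

definition num_triangles :: "nat set \<Rightarrow> nat" where
  "num_triangles x = card x"

text \<open>
  Fusion.  The edge \<open>xz\<close> consists of the darts \<open>d\<close> (from \<open>x\<close> to \<open>z\<close>) and \<open>d'\<close>, and the sides of
  the quadrilateral are \<open>a'\<close> from \<open>x\<close> to \<open>y\<close>, \<open>b'\<close> from \<open>y\<close> to \<open>z\<close>, \<open>a\<close> from \<open>z\<close> to \<open>w\<close> and \<open>b\<close>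
  from \<open>w\<close> to \<open>x\<close>.  Afterwards \<open>d\<close> runs from \<open>y\<close> to \<open>w\<close>, and the triangles are \<open>d b a'\<close> and
  \<open>d' b' a\<close>.  Two different triangles must meet in the edge; coincidences among
  \<open>x, y, z, w\<close> are allowed.
\<close>

definition fusion :: "tri_map \<Rightarrow> tri_map \<Rightarrow> bool" where
  "fusion T T' \<longleftrightarrow>
     (\<exists>d\<in>darts T. \<exists>a b d' a' b'.
        a = nxt T d \<and> b = nxt T a \<and> d' = opp T d \<and> a' = nxt T d' \<and> b' = nxt T a' \<and>
        d' \<notin> {d, a, b} \<and>
        T' = T\<lparr>nxt := (nxt T)(d := b, b := a', a' := d, d' := b', b' := a, a := d')\<rparr>)"

text \<open>
  Bubble.  The two sides \<open>d\<close> (from \<open>x\<close> to \<open>y\<close>) and \<open>d'\<close> of an edge are unglued, and the bigon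
  between them is filled by the triangles \<open>p1 p2 p3\<close>, glued to \<open>d\<close>, and \<open>q1 q2 q3\<close>, glued to \<open>d'\<close>.
  The new vertex is the common initial vertex of \<open>p3\<close> and \<open>q3\<close>.
\<close>

definition bubble :: "tri_map \<Rightarrow> tri_map \<Rightarrow> bool" where
  "bubble T T' \<longleftrightarrow>
     (\<exists>d\<in>darts T. \<exists>d' p1 p2 p3 q1 q2 q3.
        d' = opp T d \<and> distinct [p1, p2, p3, q1, q2, q3] \<and>
        {p1, p2, p3, q1, q2, q3} \<inter> darts T = {} \<and>
        T' = \<lparr>darts = darts T \<union> {p1, p2, p3, q1, q2, q3},
              opp = (opp T)(d := p1, p1 := d, d' := q1, q1 := d',
                            p2 := q3, q3 := p2, p3 := q2, q2 := p3),
              nxt = (nxt T)(p1 := p2, p2 := p3, p3 := p1, q1 := q2, q2 := q3, q3 := q1)\<rparr>)"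

text \<open>
  A finite-dimensional commutative complex algebra with basis \<open>\<phi> 0, \<dots>, \<phi> K\<close>.  The norm only
  supplies the topology for \<^const>\<open>exp\<close>; every finite-dimensional unital algebra other than zero
  admits such a norm, and all such norms are equivalent.
\<close>

locale operator_algebra =
  fixes smul :: "complex \<Rightarrow> 'a::{real_normed_algebra_1, banach, comm_ring_1} \<Rightarrow> 'a"
    and \<phi> :: "nat \<Rightarrow> 'a"
    and K :: nat
  assumes basis: "finite_dimensional_vector_space smul (\<phi> ` {..K})"
    and inj_basis: "inj_on \<phi> {..K}"
    and smul_of_real: "smul (of_real r) u = r *\<^sub>R u"
    and smul_mult: "smul c u * v = smul c (u * v)"

text \<open>
  Insertions do not depend on location, so the insertion of \<open>O\<^sub>\<alpha>\<close> at any vertex is the basis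
  element \<open>\<phi> \<alpha>\<close>.
\<close>

definition delta_S ::
  "(complex \<Rightarrow> 'a \<Rightarrow> 'a::ab_group_add) \<Rightarrow> (nat \<Rightarrow> 'a) \<Rightarrow> nat \<Rightarrow> (nat \<Rightarrow> nat \<Rightarrow> complex)
    \<Rightarrow> tri_map \<Rightarrow> 'a"
  where
  "delta_S smul \<phi> K f T =
     (\<Sum>\<alpha>\<le>K. \<Sum>x\<in>vertices T. smul (f \<alpha> (num_triangles x)) (\<phi> \<alpha>))"

definition exp_invariant ::
  "(complex \<Rightarrow> 'a \<Rightarrow> 'a::{real_normed_algebra_1, banach}) \<Rightarrow> (nat \<Rightarrow> 'a) \<Rightarrow> nat
    \<Rightarrow> (nat \<Rightarrow> nat \<Rightarrow> complex) \<Rightarrow> bool"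
  where
  "exp_invariant smul \<phi> K f \<longleftrightarrow>
     (\<forall>T T'. triangulation T \<and> (fusion T T' \<or> bubble T T') \<longrightarrow>
        exp (- delta_S smul \<phi> K f T') =
        exp (- delta_S smul \<phi> K f T))"

text \<open>
  \<open>f\<close> is reached by switching the couplings on continuously, starting from the unperturbed theory,
  with \<open>exp (- \<delta>S)\<close> invariant all along.  Without such a condition, \<open>exp (- \<delta>S)\<close> determines \<open>\<delta>S\<close>
  only up to periods of \<^const>\<open>exp\<close> (for instance \<open>\<i> 2\<pi>\<close> times the unit), and integer multiples of
  these could be added to the action at each vertex in an arbitrary way.
\<close>

definition invariant_perturbation ::
  "(complex \<Rightarrow> 'a \<Rightarrow> 'a::{real_normed_algebra_1, banach}) \<Rightarrow> (nat \<Rightarrow> 'a) \<Rightarrow> nat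
    \<Rightarrow> (nat \<Rightarrow> nat \<Rightarrow> complex) \<Rightarrow> bool"
  where
  "invariant_perturbation smul \<phi> K f \<longleftrightarrow>
     (\<exists>g. (\<forall>\<alpha>\<le>K. \<forall>n\<ge>1. continuous_on {0..1} (\<lambda>t::real. g t \<alpha> n) \<and>
                         g 0 \<alpha> n = 0 \<and> g 1 \<alpha> n = f \<alpha> n) \<and>
          (\<forall>t\<in>{0..1}. exp_invariant smul \<phi> K (g t)))"

end

(*
  The kernel of exp is discrete at 0, so the change of the action under a move, which varies
  continuously while the couplings are switched on, vanishes identically; by linear independence
  of the basis each h = f alpha then has an invariant vertex sum.  Take n bigons arranged cyclically
  between a vertex N of degree n and a vertex S of degree 4 n, each bigon consisting of a triangle
  N S S and a triangle S S U folded around a vertex U of degree 1.  Comparing the bubble on an edge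
  N S with that on an edge S U shows that h (n + 2) - h n does not depend on n.  For n = 1, the
  fusion on the loop at S yields the sphere of two triangles with vertex degrees 2, 2, 2, and this
  fixes the remaining parity-dependent freedom.
*)

theory Submission
  imports Defs
begin

section \<open>Discreteness of the kernel of the exponential\<close>

text \<open>When \<open>exp u = 1\<close>, the series from its quadratic term on sums to
  \<open>- u\<close>. Its norm is at most \<open>exp (norm u) - 1 - norm u\<close>, hence at most
  \<open>norm u ^ 2\<close>, and this is below \<open>norm u\<close> unless
  \<open>u = 0\<close>.\<close>

lemma exp_eq_1_imp_zero:
  fixes u :: "'a::{real_normed_algebra_1, banach}"
  assumes "exp u = 1" "norm u < 1"
  shows "u = 0"
proof -
  have a: "(\<lambda>n. u ^ (n + 2) /\<^sub>R fact (n + 2)) sums (- u)"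
    using sums_split_initial_segment[OF exp_converges[of u], of 2] assms(1)
    by (simp add: numeral_2_eq_2)
  have b: "(\<lambda>n. norm u ^ (n + 2) /\<^sub>R fact (n + 2)) sums (exp (norm u) - 1 - norm u)"
    using sums_split_initial_segment[OF exp_converges[of "norm u"], of 2]
    by (simp add: numeral_2_eq_2 algebra_simps)
  have "norm (- u) \<le> exp (norm u) - 1 - norm u"
  proof (rule norm_sums_le[OF a b])
    fix n
    have "norm (u ^ (n + 2)) \<le> norm u ^ (n + 2)" by (rule norm_power_ineq)
    then show "norm (u ^ (n + 2) /\<^sub>R fact (n + 2)) \<le> norm u ^ (n + 2) /\<^sub>R fact (n + 2)"
      by (simp add: divide_right_mono divide_inverse mult.commute)
  qed
  also have "\<dots> \<le> norm u ^ 2"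
    using exp_bound[of "norm u"] assms(2) by simp
  finally have "norm u * (1 - norm u) \<le> 0"
    by (simp add: power2_eq_square algebra_simps)
  then show ?thesis
    using assms(2) by (simp add: mult_le_0_iff)
qed

text \<open>By commutativity, the difference of two values of \<open>D\<close> again has exponential
  1, so distinct values are at distance at least 1. A continuous path with such a discrete range is
  constant.\<close>

lemma exp_eq_1_path_const_zero:
  fixes D :: "real \<Rightarrow> 'a::{real_normed_algebra_1, banach, comm_ring_1}"
  assumes cont: "continuous_on {0..1} D" and "D 0 = 0"
    and exp1: "\<And>t. t \<in> {0..1} \<Longrightarrow> exp (D t) = 1"
  shows "D 1 = 0"
proof -
  have "D constant_on {0..1}"
  proof (rule continuous_discrete_range_constant[OF _ cont])
    fix s :: real assume s: "s \<in> {0..1}"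
    have "1 \<le> norm (D t - D s)" if "t \<in> {0..1}" "D t \<noteq> D s" for t
    proof (rule ccontr)
      have "exp (D t - D s) = exp (D t) * exp (- D s)"
        using exp_add_commuting[of "D t" "- D s"] by (simp add: mult.commute)
      also have "\<dots> = 1"
        using exp_minus_inverse[of "D s"] exp1[OF s] exp1[OF that(1)] by simp
      finally have "exp (D t - D s) = 1" .
      moreover assume "\<not> 1 \<le> norm (D t - D s)"
      ultimately show False
        using exp_eq_1_imp_zero[of "D t - D s"] that(2) by simp
    qed
    then show "\<exists>e>0. \<forall>t. t \<in> {0..1} \<and> D t \<noteq> D s \<longrightarrow> e \<le> norm (D t - D s)"
      by (intro exI[of _ 1]) auto
  qed simp
  then show ?thesis
    using \<open>D 0 = 0\<close> unfolding constant_on_def by (metis atLeastAtMost_iff order_refl zero_le_one)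
qed

section \<open>From invariance of the exponential to invariant vertex sums\<close>

context operator_algebra
begin

sublocale finite_dimensional_vector_space smul "\<phi> ` {..K}"
  by (rule basis)

text \<open>Only real scalars are tied to the norm, by \<open>smul_of_real\<close>. Splitting the
  complex scalar into real and imaginary part reduces the claim to real scaling of the fixed vectors
  \<open>u\<close> and \<open>smul \<i> u\<close>.\<close>

lemma continuous_on_smul_left:
  assumes "continuous_on S g"
  shows "continuous_on S (\<lambda>t. smul (g t) u)"
proof -
  have "smul c u = Re c *\<^sub>R u + Im c *\<^sub>R smul \<i> u" for c
  proof -
    have "smul c u = smul (of_real (Re c) + of_real (Im c) * \<i>) u"
      by (simp add: complex_eq mult.commute)
    then show ?thesis
      by (simp add: scale_left_distrib smul_of_real flip: scale_scale)
  qed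
  then have "(\<lambda>t. smul (g t) u) = (\<lambda>t. Re (g t) *\<^sub>R u + Im (g t) *\<^sub>R smul \<i> u)"
    by (intro ext)
  then show ?thesis
    by (rule ssubst) (intro continuous_intros assms)
qed

text \<open>Independence is a property of the set of basis vectors; injectivity of
  \<open>\<phi>\<close> carries the indexed coefficients over to that set.\<close>

lemma sum_basis_eq_zeroD:
  assumes "(\<Sum>\<alpha>\<le>K. smul (c \<alpha>) (\<phi> \<alpha>)) = 0" "\<alpha> \<le> K"
  shows "c \<alpha> = 0"
proof -
  define u where "u v = c (the_inv_into {..K} \<phi> v)" for v
  have u: "u (\<phi> \<beta>) = c \<beta>" if "\<beta> \<le> K" for \<beta>
    using that by (simp add: u_def the_inv_into_f_f[OF inj_basis])
  have "(\<Sum>v\<in>\<phi> ` {..K}. smul (u v) v) = 0"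
    using assms(1) by (simp add: sum.reindex[OF inj_basis] u)
  then have "u (\<phi> \<alpha>) = 0"
    using independentD[OF independent_Basis, of "\<phi> ` {..K}" u "\<phi> \<alpha>"] assms(2) by simp
  then show ?thesis
    using u[OF assms(2)] by simp
qed

text \<open>
  Since \<^const>\<open>exp\<close> is injective near \<open>0\<close>, the change of \<open>\<delta>S\<close> under a move stays zero while the
  couplings are switched on.  The couplings are controlled only at positive arguments, hence the
  condition on the vertices.
\<close>

lemma vertex_sum_invariant:
  assumes pert: "invariant_perturbation smul \<phi> K f"
    and T: "triangulation T" and move: "fusion T T' \<or> bubble T T'"
    and pos: "\<And>x. x \<in> vertices T \<union> vertices T' \<Longrightarrow> 1 \<le> card x"
    and "\<alpha> \<le> K"
  shows "(\<Sum>x\<in>vertices T'. f \<alpha> (card x)) = (\<Sum>x\<in>vertices T. f \<alpha> (card x))"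
proof -
  obtain g where g: "\<And>\<alpha> n. \<alpha> \<le> K \<Longrightarrow> 1 \<le> n \<Longrightarrow> continuous_on {0..1} (\<lambda>t::real. g t \<alpha> n)"
      "\<And>\<alpha> n. \<alpha> \<le> K \<Longrightarrow> 1 \<le> n \<Longrightarrow> g 0 \<alpha> n = 0" "\<And>\<alpha> n. \<alpha> \<le> K \<Longrightarrow> 1 \<le> n \<Longrightarrow> g 1 \<alpha> n = f \<alpha> n"
    and inv: "\<And>t. t \<in> {0..1} \<Longrightarrow> exp_invariant smul \<phi> K (g t)"
    using pert unfolding invariant_perturbation_def by metis
  \<comment> \<open>Grouped by operators, the change of the action under the move has coordinates
    \<open>c t \<alpha>\<close> in the basis.\<close>
  define c where
    "c t \<alpha> = (\<Sum>x\<in>vertices T'. g t \<alpha> (card x)) - (\<Sum>x\<in>vertices T. g t \<alpha> (card x))" for t \<alpha>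
  define D where "D t = (\<Sum>\<alpha>\<le>K. smul (c t \<alpha>) (\<phi> \<alpha>))" for t
  have D: "D t = delta_S smul \<phi> K (g t) T' - delta_S smul \<phi> K (g t) T" for t
    unfolding D_def c_def delta_S_def num_triangles_def
    by (simp add: scale_left_diff_distrib scale_sum_left sum_subtractf)
  have "D 1 = 0"
  proof (rule exp_eq_1_path_const_zero)
    have "continuous_on {0..1} (\<lambda>t. c t \<alpha>)" if "\<alpha> \<le> K" for \<alpha>
      unfolding c_def by (intro continuous_intros g(1) that) (use pos in auto)
    then show "continuous_on {0..1} D"
      unfolding D_def by (intro continuous_on_sum continuous_on_smul_left) auto
    have "c 0 \<alpha> = 0" if "\<alpha> \<le> K" for \<alpha>
      unfolding c_def using that pos by (simp add: g(2) del: One_nat_def)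
    then show "D 0 = 0"
      unfolding D_def by (intro sum.neutral) auto
    fix t :: real assume "t \<in> {0..1}"
    then have eq: "exp (- delta_S smul \<phi> K (g t) T') = exp (- delta_S smul \<phi> K (g t) T)"
      using inv T move unfolding exp_invariant_def by blast
    have "exp (D t) = exp (delta_S smul \<phi> K (g t) T') * exp (- delta_S smul \<phi> K (g t) T)"
      unfolding D
      using exp_add_commuting[of "delta_S smul \<phi> K (g t) T'" "- delta_S smul \<phi> K (g t) T"]
      by (simp add: mult.commute)
    then show "exp (D t) = 1"
      unfolding eq[symmetric] by (simp only: exp_minus_inverse)
  qed
  then have "c 1 \<alpha> = 0"
    unfolding D_def using sum_basis_eq_zeroD[of "c 1" \<alpha>] \<open>\<alpha> \<le> K\<close> by blast
  then show ?thesis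
    unfolding c_def using pos \<open>\<alpha> \<le> K\<close> by (simp add: g(3) del: One_nat_def)
qed

end

section \<open>Solving the recurrences\<close>

text \<open>Subtracting \<open>US\<close> from \<open>NS\<close> gives the constant increment
  \<beta> over two steps, separately on odd and even arguments. \<open>US\<close> at 1 then fixes
  \<open>h 2\<close>, and \<open>fuse\<close> ties \<open>h 1\<close> to the even values, so that
  \<open>A = \<beta> / 2\<close>.\<close>

lemma deficit_form:
  fixes h :: "nat \<Rightarrow> complex"
  assumes NS: "\<And>n. 1 \<le> n \<Longrightarrow> h n + h (4 * n) = h (n + 2) + h (4 * n + 2) + h 2"
    and US: "\<And>n. 1 \<le> n \<Longrightarrow> h 1 + h (4 * n) = h 3 + h (4 * n + 2) + h 2"
    and fuse: "2 * h 1 + h 4 = 3 * h 2"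
  shows "\<exists>A. \<forall>n\<ge>1. h n = A * (of_nat n - 6)"
proof -
  define \<beta> where "\<beta> = h 3 - h 1"
  have step: "h (n + 2) = h n + \<beta>" if "1 \<le> n" for n
    using NS[OF that] US[OF that] unfolding \<beta>_def by algebra
  have h2: "h 2 = - 2 * \<beta>"
  proof -
    have "h 1 + h 4 = h 3 + h 6 + h 2" "h 6 = h 4 + \<beta>"
      using US[of 1] step[of 4] by simp_all
    then show ?thesis unfolding \<beta>_def by algebra
  qed
  have h1: "h 1 = - 5 * \<beta> / 2"
  proof -
    have "h 4 = h 2 + \<beta>" using step[of 2] by simp
    then show ?thesis using fuse h2 by (simp add: field_simps)
  qed
  have "h n = \<beta> / 2 * (of_nat n - 6)" if "1 \<le> n" for n
    using that
  proof (induction n rule: less_induct)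
    case (less n)
    \<comment> \<open>The recurrence advances by two, hence two base cases.\<close>
    consider "n = 1" | "n = 2" | m where "n = m + 2" "1 \<le> m"
    proof -
      have "n = 1 \<or> n = 2 \<or> n = (n - 2) + 2 \<and> 1 \<le> n - 2"
        using less.prems by arith
      then show ?thesis using that by blast
    qed
    then show ?case
    proof cases
      case 3
      then show ?thesis using less.IH[of m] step[of m] by (simp add: field_simps)
    qed (use h1 h2 in simp_all)
  qed
  then show ?thesis by blast
qed

section \<open>Vertices as orbits of the rotation\<close>

lemma orbit_transposed_pair:
  assumes "f a = b" "f b = a"
  shows "orbit f a = {a, b}"
proof
  show "orbit f a \<subseteq> {a, b}"
  proof
    fix e assume "e \<in> orbit f a"
    then show "e \<in> {a, b}" by induction (use assms in auto)
  qed
  show "{a, b} \<subseteq> orbit f a"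
    using assms orbit.base[of f a] orbit.step[of b f a] by (metis empty_subsetI insert_subset)
qed

lemma rot_permutes:
  assumes "triangulation T"
  shows "rot T permutes darts T"
proof -
  have "rot T = opp T \<circ> (nxt T \<circ> nxt T)"
    by (auto simp: rot_def)
  then show ?thesis
    using assms unfolding triangulation_def by (metis permutes_compose)
qed

lemma finite_vertices: "triangulation T \<Longrightarrow> finite (vertices T)"
  by (simp add: triangulation_def vertices_def)

text \<open>\<open>orbit\<close> starts from the image of its base point; that a dart belongs to its
  own vertex relies on the rotation being a permutation of a finite set.\<close>

lemma triangulation_orbit:
  assumes "triangulation T" "e \<in> darts T"
  shows "e \<in> orbit (rot T) e" "orbit (rot T) e \<subseteq> darts T" "finite (orbit (rot T) e)"
proof -
  have fin: "finite (darts T)" using assms(1) by (simp add: triangulation_def)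
  then show "e \<in> orbit (rot T) e"
    using permutation_self_in_orbit permutation_permutes rot_permutes[OF assms(1)] by metis
  show "orbit (rot T) e \<subseteq> darts T"
    using permutes_orbit_subset[OF rot_permutes[OF assms(1)] assms(2)] .
  then show "finite (orbit (rot T) e)"
    using fin finite_subset by blast
qed

text \<open>Orbits of a permutation of a finite set are cycles, so the vertices partition the
  darts.\<close>

lemma triangulation_orbit_eq:
  assumes "triangulation T" "e \<in> darts T" "e' \<in> orbit (rot T) e"
  shows "orbit (rot T) e' = orbit (rot T) e"
proof (rule orbit_cyclic_eq3[OF _ assms(3)])
  show "cyclic_on (rot T) (orbit (rot T) e)"
    using cyclic_on_orbit[OF rot_permutes[OF assms(1)]] assms(1)
    by (simp add: triangulation_def)
qed

lemma card_vertex_pos: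
  assumes "triangulation T" "x \<in> vertices T"
  shows "1 \<le> card x"
proof -
  obtain e where "e \<in> darts T" "x = orbit (rot T) e"
    using assms(2) by (auto simp: vertices_def)
  then have "e \<in> x" "finite x"
    using triangulation_orbit[OF assms(1)] by simp_all
  then show ?thesis
    by (metis One_nat_def Suc_leI card_gt_0_iff empty_iff)
qed

section \<open>Effect of a bubble on the vertices\<close>

text \<open>Here \<open>r\<close> and \<open>s\<close> stand for the rotation before and after a
  bubble: \<open>s\<close> follows \<open>r\<close> except that it passes through \<open>q1\<close>,
  \<open>p2\<close> before arriving at \<open>d\<close>, and through \<open>p1\<close>,
  \<open>q2\<close> before arriving at \<open>d'\<close>.\<close>

lemma orbit_insert_two_pairs:
  assumes r: "\<And>y. y \<in> D \<Longrightarrow> r y \<in> D" and "e \<in> D" and self: "e \<in> orbit r e"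
    and s: "\<And>y. y \<in> D \<Longrightarrow> s y = (if r y = d then q1 else if r y = d' then p1 else r y)"
    and s_new: "s q1 = p2" "s p2 = d" "s p1 = q2" "s q2 = d'"
    and "d \<noteq> d'"
  shows "orbit s e = orbit r e \<union> (if d \<in> orbit r e then {q1, p2} else {})
    \<union> (if d' \<in> orbit r e then {p1, q2} else {})" (is "_ = ?G")
proof
  have D: "y \<in> D" if "y \<in> orbit r e" for y
    using that by induction (auto simp: r \<open>e \<in> D\<close>)
  have closed: "s y \<in> ?G" if "y \<in> ?G" for y
  proof -
    consider "y \<in> orbit r e" | "d \<in> orbit r e" "y = q1 \<or> y = p2"
      | "d' \<in> orbit r e" "y = p1 \<or> y = q2"
      using \<open>y \<in> ?G\<close> by (auto split: if_splits)
    then show ?thesis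
    proof cases
      case 1
      then have "r y \<in> orbit r e" by (rule orbit.step)
      then show ?thesis using s[OF D[OF 1]] by auto
    qed (auto simp: s_new)
  qed
  show "orbit s e \<subseteq> ?G"
  proof
    fix y assume "y \<in> orbit s e"
    then show "y \<in> ?G"
    proof induction
      case base
      show ?case using self by (intro closed) blast
    next
      case (step y)
      then show ?case by (intro closed)
    qed
  qed
  \<comment> \<open>A detour ends at the dart that \<open>r\<close> would have reached
    directly.\<close>
  have reach: "r y \<in> orbit s e" if "y \<in> D" "s y \<in> orbit s e" for y
    using s[OF that(1)] that(2) s_new orbit.step[of _ s e] \<open>d \<noteq> d'\<close> by metis
  have sub: "y \<in> orbit s e" if "y \<in> orbit r e" for y
    using that
  proof induction
    case base
    show ?case by (intro reach \<open>e \<in> D\<close> orbit.base)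
  next
    case (step y)
    then show ?case by (intro reach D orbit.step)
  qed
  \<comment> \<open>A detour is entered from an \<open>r\<close>-predecessor of \<open>d\<close> or
    \<open>d'\<close>, so that predecessor must lie in the \<open>s\<close>-orbit.\<close>
  have pred: "\<exists>z. z \<in> D \<and> z \<in> orbit s e \<and> y = r z" if "y \<in> orbit r e" for y
    using that
  proof cases
    case base
    then show ?thesis using sub[OF self] \<open>e \<in> D\<close> by blast
  next
    case (step z)
    then show ?thesis using sub D by blast
  qed
  have "{q1, p2} \<subseteq> orbit s e" if "d \<in> orbit r e"
    using pred[OF that] s s_new orbit.step[of _ s e] by (metis empty_subsetI insert_subset)
  moreover have "{p1, q2} \<subseteq> orbit s e" if "d' \<in> orbit r e"
    using pred[OF that] s s_new \<open>d \<noteq> d'\<close> orbit.step[of _ s e] by (metis empty_subsetI insert_subset)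
  ultimately show "?G \<subseteq> orbit s e"
    using sub by auto
qed

text \<open>Since the end points differ, each receives exactly one of the two detours and gains two
  darts, while \<open>p3\<close> and \<open>q3\<close> form the new vertex. Positive degrees are
  derived here from the explicit vertices of \<open>T'\<close>, without showing that
  \<open>T'\<close> is a triangulation.\<close>

lemma bubble_vertices:
  assumes T: "triangulation T" and d: "d \<in> darts T"
    and xy: "x = orbit (rot T) d" "y = orbit (rot T) (opp T d)" "x \<noteq> y"
  obtains T' where "bubble T T'" "\<And>v. v \<in> vertices T' \<Longrightarrow> 1 \<le> card v"
    "\<And>h :: nat \<Rightarrow> complex. (\<Sum>v\<in>vertices T'. h (card v)) + h (card x) + h (card y) =
       (\<Sum>v\<in>vertices T. h (card v)) + h (card x + 2) + h (card y + 2) + h 2"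
proof -
  define d' where "d' = opp T d"
  let ?D = "darts T" and ?r = "rot T"
  have perm: "opp T permutes ?D" "nxt T permutes ?D" and fin: "finite ?D"
    and opp: "\<And>e. e \<in> ?D \<Longrightarrow> opp T (opp T e) = e" "\<And>e. e \<in> ?D \<Longrightarrow> opp T e \<noteq> e"
    using T unfolding triangulation_def by auto
  have d': "d' \<in> ?D" "d \<noteq> d'" "opp T d' = d"
    using d opp[OF d] perm by (auto simp: d'_def permutes_in_image)
  have nxtD: "nxt T e \<in> ?D" if "e \<in> ?D" for e
    using that perm by (simp add: permutes_in_image)
  have rD: "?r e \<in> ?D" if "e \<in> ?D" for e
    using that rot_permutes[OF T] by (simp add: permutes_in_image)
  \<comment> \<open>A strict upper bound of the darts supplies six fresh ones, \<open>m\<close> to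
    \<open>m + 5\<close>.\<close>
  obtain m where m: "\<And>e. e \<in> ?D \<Longrightarrow> e < m"
    using fin finite_nat_set_iff_bounded by auto
  define p1 p2 p3 q1 q2 q3 where
    pq: "p1 = m" "p2 = m + 1" "p3 = m + 2" "q1 = m + 3" "q2 = m + 4" "q3 = m + 5"
  let ?P = "{p1, p2, p3, q1, q2, q3}"
  have dist: "distinct [p1, p2, p3, q1, q2, q3]" by (simp add: pq)
  have new: "p1 \<notin> ?D" "p2 \<notin> ?D" "p3 \<notin> ?D" "q1 \<notin> ?D" "q2 \<notin> ?D" "q3 \<notin> ?D"
    using m unfolding pq by force+
  define T' where "T' = \<lparr>darts = ?D \<union> ?P,
              opp = (opp T)(d := p1, p1 := d, d' := q1, q1 := d',
                            p2 := q3, q3 := p2, p3 := q2, q2 := p3),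
              nxt = (nxt T)(p1 := p2, p2 := p3, p3 := p1, q1 := q2, q2 := q3, q3 := q1)\<rparr>"
  let ?s = "rot T'"
  have "?P \<inter> ?D = {}" using new by blast
  then have "bubble T T'"
    unfolding bubble_def T'_def using d dist d'_def by blast
  have neD: "e \<noteq> p1" "e \<noteq> p2" "e \<noteq> p3" "e \<noteq> q1" "e \<noteq> q2" "e \<noteq> q3" if "e \<in> ?D" for e
    using that new by metis+
  note ne = neD[OF d] neD[OF d'(1)]
  \<comment> \<open>Among old darts only \<open>d\<close> and \<open>d'\<close> are reglued, so the
    rotation changes exactly where it used to arrive at one of them.\<close>
  have s_old: "?s e = (if ?r e = d then q1 else if ?r e = d' then p1 else ?r e)" if "e \<in> ?D" for e
  proof -
    define c where "c = nxt T (nxt T e)"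
    have c: "c \<in> ?D" using that nxtD by (simp add: c_def)
    have "nxt T' (nxt T' e) = c"
      using neD[OF that] neD[OF nxtD[OF that]] by (simp add: T'_def c_def)
    then have "?s e = opp T' c" "?r e = opp T c" by (simp_all add: rot_def c_def)
    moreover have "opp T c = d \<longleftrightarrow> c = d'" "opp T c = d' \<longleftrightarrow> c = d"
      using opp(1)[OF c] d'(3) d'_def by metis+
    moreover have "opp T' c = (if c = d' then q1 else if c = d then p1 else opp T c)"
      using \<open>d \<noteq> d'\<close> ne neD[OF c] by (simp add: T'_def)
    ultimately show ?thesis by simp
  qed
  have s_new: "?s q1 = p2" "?s p2 = d" "?s p1 = q2" "?s q2 = d'" "?s p3 = q3" "?s q3 = p3"
    using dist ne \<open>d \<noteq> d'\<close> by (auto simp: rot_def T'_def)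
  \<comment> \<open>\<open>F\<close> sends an old vertex to the vertex of \<open>T'\<close> that
    extends it.\<close>
  define F where "F v = v \<union> (if d \<in> v then {q1, p2} else {}) \<union> (if d' \<in> v then {p1, q2} else {})"
    for v
  have F: "orbit ?s e = F (orbit ?r e)" if "e \<in> ?D" for e
    unfolding F_def using that d' triangulation_orbit[OF T] rD s_old s_new
    by (intro orbit_insert_two_pairs[where D = ?D]) auto
  have self: "d \<in> x" "d' \<in> y"
    using triangulation_orbit[OF T] d d' xy by (auto simp: d'_def)
  have split: "d' \<notin> x" "d \<notin> y"
    using triangulation_orbit_eq[OF T d, of d'] triangulation_orbit_eq[OF T d'(1), of d] xy d'_def
    by metis+
  have xyD: "x \<in> vertices T" "y \<in> vertices T"
    using d d' xy unfolding vertices_def d'_def by auto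
  have Fx: "F x = x \<union> {q1, p2}" and Fy: "F y = y \<union> {p1, q2}"
    using self split by (auto simp: F_def)
  have F_other: "F v = v" if v: "v \<in> vertices T" "v \<noteq> x" "v \<noteq> y" for v
  proof -
    obtain e where e: "e \<in> ?D" "v = orbit ?r e"
      using v(1) unfolding vertices_def by auto
    then have "d \<notin> v" "d' \<notin> v"
      using v triangulation_orbit_eq[OF T e(1)] e(2) xy d'_def by metis+
    then show ?thesis by (simp add: F_def)
  qed
  have orbit_s: "orbit ?s (?s e) = orbit ?s e" if "e \<in> orbit ?s e" for e
    using self_in_orbit_step[OF that] .
  have vsub: "v \<subseteq> ?D" "finite v" if "v \<in> vertices T" for v
    using that triangulation_orbit[OF T] unfolding vertices_def by auto
  have orb_d: "orbit ?s d = F x" and orb_d': "orbit ?s d' = F y"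
    using F[OF d] F[OF d'(1)] xy d'_def by simp_all
  have orb_pq: "orbit ?s p3 = {p3, q3}" "orbit ?s q3 = {p3, q3}"
    using s_new by (simp_all add: orbit_transposed_pair insert_commute)
  have orb_q1: "orbit ?s q1 = F x" "orbit ?s p2 = F x"
  proof -
    have "q1 \<in> orbit ?s d" "p2 \<in> orbit ?s d" "d \<in> orbit ?s d"
      using orb_d Fx self by auto
    then show "orbit ?s q1 = F x" "orbit ?s p2 = F x"
      using orb_d orbit_s s_new by (metis self_in_orbit_trans)+
  qed
  have orb_p1: "orbit ?s p1 = F y" "orbit ?s q2 = F y"
  proof -
    have "p1 \<in> orbit ?s d'" "q2 \<in> orbit ?s d'" "d' \<in> orbit ?s d'"
      using orb_d' Fy self by auto
    then show "orbit ?s p1 = F y" "orbit ?s q2 = F y"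
      using orb_d' orbit_s s_new by (metis self_in_orbit_trans)+
  qed
  have darts': "darts T' = ?D \<union> ?P" by (simp add: T'_def)
  have V: "vertices T = insert x (insert y (vertices T - {x, y}))"
    using xyD by blast
  have V': "vertices T' = insert {p3, q3} (insert (F x) (insert (F y) (vertices T - {x, y})))"
  proof -
    have "vertices T' = orbit ?s ` ?D \<union> {{p3, q3}, F x, F y}"
      using orb_pq orb_q1 orb_p1 by (simp add: vertices_def darts' image_Un insert_commute)
    also have "orbit ?s ` ?D = F ` vertices T"
      unfolding vertices_def image_image using F by (intro image_cong) auto
    also have "F ` vertices T = insert (F x) (insert (F y) (vertices T - {x, y}))"
    proof -
      have "F ` (vertices T - {x, y}) = vertices T - {x, y}"
        using F_other by force
      then have "F ` insert x (insert y (vertices T - {x, y})) =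
          insert (F x) (insert (F y) (vertices T - {x, y}))"
        by (simp only: image_insert)
      then show ?thesis by (simp only: V[symmetric])
    qed
    finally show ?thesis by blast
  qed
  have newx: "q1 \<notin> x" "p2 \<notin> x" "p3 \<notin> x" "p1 \<notin> y" "q2 \<notin> y" "p3 \<notin> y" "q1 \<notin> y"
    using vsub(1)[OF xyD(1)] vsub(1)[OF xyD(2)] new by blast+
  \<comment> \<open>Each of these sets contains a fresh dart, so none is an old vertex and the sum
    over \<open>vertices T'\<close> splits without collisions.\<close>
  have notin: "F x \<notin> vertices T - {x, y}" "F y \<notin> vertices T - {x, y}"
    "{p3, q3} \<notin> vertices T - {x, y}"
    using vsub(1) new unfolding Fx Fy by blast+
  have "q1 \<in> F x" "q1 \<notin> F y" "p3 \<notin> F x" "p3 \<notin> F y"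
    using newx dist unfolding Fx Fy by auto
  then have neq: "F x \<noteq> F y" "{p3, q3} \<noteq> F x" "{p3, q3} \<noteq> F y"
    by blast+
  have cards: "card (F x) = card x + 2" "card (F y) = card y + 2" "card {p3, q3} = 2"
    using vsub(2)[OF xyD(1)] vsub(2)[OF xyD(2)] newx dist unfolding Fx Fy
    by (auto simp: card_insert_if)
  show thesis
  proof
    show "bubble T T'" by fact
    show "1 \<le> card v" if "v \<in> vertices T'" for v
      using that cards card_vertex_pos[OF T] unfolding V' by auto
    fix h :: "nat \<Rightarrow> complex"
    have "(\<Sum>v\<in>vertices T. h (card v)) = h (card x) + h (card y) + (\<Sum>v\<in>vertices T - {x, y}. h (card v))"
    proof -
      have "(\<Sum>v\<in>vertices T. h (card v)) = (\<Sum>v\<in>insert x (insert y (vertices T - {x, y})). h (card v))"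
        using V by (rule sum.cong) simp
      then show ?thesis using finite_vertices[OF T] \<open>x \<noteq> y\<close> by simp
    qed
    moreover have "(\<Sum>v\<in>vertices T'. h (card v)) =
        h 2 + h (card x + 2) + h (card y + 2) + (\<Sum>v\<in>vertices T - {x, y}. h (card v))"
      unfolding V' using finite_vertices[OF T] notin neq cards by simp
    ultimately show "(\<Sum>v\<in>vertices T'. h (card v)) + h (card x) + h (card y) =
       (\<Sum>v\<in>vertices T. h (card v)) + h (card x + 2) + h (card y + 2) + h 2"
      by simp
  qed
qed

section \<open>The cyclic arrangement of folded bigons\<close>

definition dart :: "nat \<Rightarrow> nat \<Rightarrow> nat" where
  "dart i k = 6 * i + k"

text \<open>
  Vertices \<open>N\<close>, \<open>S\<close> and leaves \<open>U\<^sub>i\<close>: the darts \<open>dart i k\<close> for \<open>k = 0, \<dots>, 5\<close> run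
  \<open>NS\<close>, \<open>SS\<close>, \<open>SN\<close> (outer triangle of the \<open>i\<close>-th bigon) and \<open>SS\<close>, \<open>SU\<^sub>i\<close>, \<open>U\<^sub>iS\<close> (folded triangle).
\<close>

definition fan :: "nat \<Rightarrow> tri_map" where
  "fan n = \<lparr>darts = {..<6 * n},
     opp = (\<lambda>d. if d < 6 * n then
       (let i = d div 6; k = d mod 6 in
        if k = 0 then dart (if i = 0 then n - 1 else i - 1) 2
        else if k = 1 then dart i 3
        else if k = 2 then dart (if Suc i = n then 0 else Suc i) 0
        else if k = 3 then dart i 1
        else if k = 4 then dart i 5
        else dart i 4) else d),
     nxt = (\<lambda>d. if d < 6 * n then
       (let i = d div 6; k = d mod 6 in
        dart i (if k = 2 then 0 else if k = 5 then 3 else k + 1)) else d)\<rparr>"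

lemma dart_eq_iff: "k < 6 \<Longrightarrow> l < 6 \<Longrightarrow> dart i k = dart j l \<longleftrightarrow> i = j \<and> k = l"
  unfolding dart_def by presburger

lemma dart_less_iff: "k < 6 \<Longrightarrow> dart i k < 6 * n \<longleftrightarrow> i < n"
  unfolding dart_def by presburger

lemma dart_div_mod: "k < 6 \<Longrightarrow> dart i k div 6 = i" "k < 6 \<Longrightarrow> dart i k mod 6 = k"
  unfolding dart_def by simp_all

lemma less_6_cases:
  assumes "(k::nat) < 6"
  obtains "k = 0" | "k = 1" | "k = 2" | "k = 3" | "k = 4" | "k = 5"
  using assms by arith

lemma fan_dart_iff: "k < 6 \<Longrightarrow> dart i k \<in> darts (fan n) \<longleftrightarrow> i < n"
  by (simp add: fan_def dart_less_iff)

lemma fan_dartE: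
  assumes "d \<in> darts (fan n)"
  obtains i k where "d = dart i k" "i < n" "k < 6"
proof
  show "d = dart (d div 6) (d mod 6)" by (simp add: dart_def)
  show "d div 6 < n" using assms by (simp add: fan_def)
qed simp

context
  fixes n i :: nat
  assumes i: "i < n"
begin

lemma opp_fan:
  "opp (fan n) (dart i 0) = dart (if i = 0 then n - 1 else i - 1) 2"
  "opp (fan n) (dart i 1) = dart i 3"
  "opp (fan n) (dart i 2) = dart (if Suc i = n then 0 else Suc i) 0"
  "opp (fan n) (dart i 3) = dart i 1"
  "opp (fan n) (dart i 4) = dart i 5"
  "opp (fan n) (dart i 5) = dart i 4"
  using i by (simp_all add: fan_def dart_less_iff dart_div_mod)

lemma nxt_fan:
  "nxt (fan n) (dart i 0) = dart i 1"
  "nxt (fan n) (dart i 1) = dart i 2"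
  "nxt (fan n) (dart i 2) = dart i 0"
  "nxt (fan n) (dart i 3) = dart i 4"
  "nxt (fan n) (dart i 4) = dart i 5"
  "nxt (fan n) (dart i 5) = dart i 3"
  using i by (simp_all add: fan_def dart_less_iff dart_div_mod del: One_nat_def)

text \<open>The vertices can be read off: kind 0 turns around \<open>N\<close> through increasing
  \<open>i\<close>; kinds 2, 3, 4, 1 turn around \<open>S\<close> and then pass to the preceding
  bigon; kind 5 is fixed, so each leaf has degree 1.\<close>

lemma rot_fan:
  "rot (fan n) (dart i 0) = dart (if Suc i = n then 0 else Suc i) 0"
  "rot (fan n) (dart i 1) = dart (if i = 0 then n - 1 else i - 1) 2"
  "rot (fan n) (dart i 2) = dart i 3"
  "rot (fan n) (dart i 3) = dart i 4"
  "rot (fan n) (dart i 4) = dart i 1"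
  "rot (fan n) (dart i 5) = dart i 5"
  by (simp_all only: rot_def nxt_fan opp_fan)

end

text \<open>The local conditions are checked on the six kinds of darts. For connectedness it
  suffices to reach every dart from \<open>dart 0 0\<close>, because reachability is
  symmetric.\<close>

lemma triangulation_fan:
  assumes "1 \<le> n"
  shows "triangulation (fan n)"
proof -
  let ?T = "fan n"
  have opp: "opp ?T d \<in> darts ?T \<and> opp ?T d \<noteq> d \<and> opp ?T (opp ?T d) = d" if "d \<in> darts ?T" for d
  proof -
    obtain i k where d: "d = dart i k" and "i < n" "k < 6"
      using \<open>d \<in> darts ?T\<close> by (rule fan_dartE)
    from \<open>k < 6\<close> show ?thesis
      using \<open>i < n\<close> unfolding d
      by (cases rule: less_6_cases) (auto simp: opp_fan fan_dart_iff dart_eq_iff simp del: One_nat_def)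
  qed
  have nxt: "nxt ?T d \<in> darts ?T \<and> nxt ?T d \<noteq> d \<and> nxt ?T (nxt ?T (nxt ?T d)) = d"
    if "d \<in> darts ?T" for d
  proof -
    obtain i k where d: "d = dart i k" and "i < n" "k < 6"
      using \<open>d \<in> darts ?T\<close> by (rule fan_dartE)
    from \<open>k < 6\<close> show ?thesis
      using \<open>i < n\<close> unfolding d
      by (cases rule: less_6_cases) (auto simp: nxt_fan fan_dart_iff dart_eq_iff simp del: One_nat_def)
  qed
  have "opp ?T permutes darts ?T"
  proof (rule bij_imp_permutes)
    show "bij_betw (opp ?T) (darts ?T) (darts ?T)"
      using opp by (intro bij_betw_byWitness[where f' = "opp ?T"]) auto
  qed (simp add: fan_def)
  moreover have "nxt ?T permutes darts ?T"
  proof (rule bij_imp_permutes)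
    show "bij_betw (nxt ?T) (darts ?T) (darts ?T)"
      using nxt by (intro bij_betw_byWitness[where f' = "\<lambda>d. nxt ?T (nxt ?T d)"]) auto
  qed (simp add: fan_def)
  moreover define R where
    "R = {(a, opp ?T a) | a. a \<in> darts ?T} \<union> {(a, nxt ?T a) | a. a \<in> darts ?T}"
  \<comment> \<open>\<open>opp\<close> has order 2 and \<open>nxt\<close> order 3, so every step is
    undone by further forward steps.\<close>
  have sym: "(b, a) \<in> R\<^sup>*" if "(a, b) \<in> R\<^sup>*" for a b
    using that
  proof (induction rule: rtrancl_induct)
    case (step b c)
    have "b \<in> darts ?T" and c: "c = opp ?T b \<or> c = nxt ?T b"
      using step.hyps(2) unfolding R_def by auto
    have "(c, b) \<in> R\<^sup>*"
      using c
    proof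
      assume "c = opp ?T b"
      then have "b = opp ?T c" "c \<in> darts ?T" using opp[OF \<open>b \<in> darts ?T\<close>] by auto
      then have "(c, b) \<in> R" unfolding R_def by blast
      then show ?thesis ..
    next
      assume "c = nxt ?T b"
      then have "b = nxt ?T (nxt ?T c)" "c \<in> darts ?T" "nxt ?T c \<in> darts ?T"
        using nxt[OF \<open>b \<in> darts ?T\<close>] nxt[of c] by auto
      then have "(c, nxt ?T c) \<in> R" "(nxt ?T c, b) \<in> R" unfolding R_def by blast+
      then show ?thesis by (rule converse_rtrancl_into_rtrancl[OF _ r_into_rtrancl])
    qed
    then show ?case using step.IH by (rule rtrancl_trans)
  qed simp
  have nxt_R: "(a, nxt ?T b) \<in> R\<^sup>*" if "(a, b) \<in> R\<^sup>*" "b \<in> darts ?T" for a b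
    using that unfolding R_def by (auto intro: rtrancl_into_rtrancl)
  have opp_R: "(a, opp ?T b) \<in> R\<^sup>*" if "(a, b) \<in> R\<^sup>*" "b \<in> darts ?T" for a b
    using that unfolding R_def by (auto intro: rtrancl_into_rtrancl)
  \<comment> \<open>Run along the outer triangle, cross from kind 1 to kind 3, then run along the
    folded triangle.\<close>
  have tri: "(a, dart i k) \<in> R\<^sup>*" if i: "i < n" and a: "(a, dart i 0) \<in> R\<^sup>*" and "k < 6" for a i k
  proof -
    have 1: "(a, dart i 1) \<in> R\<^sup>*" using nxt_R[OF a] i by (simp add: nxt_fan fan_dart_iff del: One_nat_def)
    have 2: "(a, dart i 2) \<in> R\<^sup>*" using nxt_R[OF 1] i by (simp add: nxt_fan fan_dart_iff del: One_nat_def)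
    have 3: "(a, dart i 3) \<in> R\<^sup>*" using opp_R[OF 1] i by (simp add: opp_fan fan_dart_iff del: One_nat_def)
    have 4: "(a, dart i 4) \<in> R\<^sup>*" using nxt_R[OF 3] i by (simp add: nxt_fan fan_dart_iff)
    have 5: "(a, dart i 5) \<in> R\<^sup>*" using nxt_R[OF 4] i by (simp add: nxt_fan fan_dart_iff)
    from \<open>k < 6\<close> show ?thesis
      by (cases rule: less_6_cases) (use a 1 2 3 4 5 in auto)
  qed
  \<comment> \<open>Side 2 of a bigon is glued to side 0 of the next one.\<close>
  have spine: "(dart 0 0, dart i 0) \<in> R\<^sup>*" if "i < n" for i
    using that
  proof (induction i)
    case (Suc i)
    then have "(dart 0 0, dart i 2) \<in> R\<^sup>*" using tri[of i "dart 0 0" 2] by simp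
    from opp_R[OF this] show ?case using Suc.prems by (simp add: opp_fan fan_dart_iff)
  qed simp
  have root: "(dart 0 0, d) \<in> R\<^sup>*" if "d \<in> darts ?T" for d
    using that
  proof (rule fan_dartE)
    fix i k assume "d = dart i k" "i < n" "k < 6"
    then show ?thesis using tri[OF _ spine] by blast
  qed
  have "(d, d') \<in> R\<^sup>*" if "d \<in> darts ?T" "d' \<in> darts ?T" for d d'
    using sym[OF root[OF that(1)]] root[OF that(2)] by (rule rtrancl_trans)
  moreover have "finite (darts ?T)" "darts ?T \<noteq> {}"
    using assms by (simp_all add: fan_def lessThan_empty_iff)
  ultimately show ?thesis
    using opp nxt unfolding triangulation_def R_def by blast
qed

lemma orbit_fan_north:
  assumes "1 \<le> n"
  shows "orbit (rot (fan n)) (dart 0 0) = (\<lambda>i. dart i 0) ` {..<n}" (is "?O = ?N")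
proof
  have closed: "rot (fan n) y \<in> ?N" if "y \<in> ?N" for y
    using that by (auto simp: rot_fan)
  show "?O \<subseteq> ?N"
  proof
    fix y assume "y \<in> ?O"
    then show "y \<in> ?N"
      by induction (use assms in \<open>auto intro!: closed\<close>)
  qed
  have "dart i 0 \<in> ?O" if "i < n" for i
    using that
  proof (induction i)
    case 0
    then show ?case
      by (intro triangulation_orbit triangulation_fan assms) (simp add: fan_dart_iff)
  next
    case (Suc i)
    then have "rot (fan n) (dart i 0) \<in> ?O" by (intro orbit.step) auto
    then show ?case using Suc.prems by (simp add: rot_fan)
  qed
  then show "?N \<subseteq> ?O" by blast
qed

text \<open>The rotation at \<open>S\<close> visits four darts of each bigon and descends from the
  last bigon to the first. The base point is the dart glued to \<open>dart 0 0\<close>, as needed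
  for the bubble on that edge.\<close>

lemma orbit_fan_south:
  assumes "1 \<le> n"
  shows "orbit (rot (fan n)) (dart (n - 1) 2) = (\<lambda>(i, k). dart i k) ` ({..<n} \<times> {1, 2, 3, 4})"
    (is "?O = ?S")
proof
  have closed: "rot (fan n) y \<in> ?S" if "y \<in> ?S" for y
  proof -
    have mem: "dart i k \<in> ?S" if "i < n" "k \<in> {1, 2, 3, 4}" for i k
      using that by blast
    obtain i k where "y = dart i k" "i < n" "k \<in> {1, 2, 3, 4}"
      using \<open>y \<in> ?S\<close> by auto
    then show ?thesis
      by (auto simp: rot_fan simp del: One_nat_def intro!: mem)
  qed
  show "?O \<subseteq> ?S"
  proof
    fix y assume "y \<in> ?O"
    then show "y \<in> ?S"
    proof induction
      case base
      have "dart (n - 1) 2 \<in> ?S" using assms by (intro image_eqI[of _ _ "(n - 1, 2)"]) auto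
      then show ?case by (rule closed)
    qed (rule closed)
  qed
  have cycle: "dart i k \<in> ?O" if "dart i 2 \<in> ?O" "i < n" "k \<in> {1, 2, 3, 4}" for i k
  proof -
    have 3: "dart i 3 \<in> ?O" using orbit.step[OF that(1)] that(2) by (simp add: rot_fan)
    have 4: "dart i 4 \<in> ?O" using orbit.step[OF 3] that(2) by (simp add: rot_fan)
    have "dart i 1 \<in> ?O" using orbit.step[OF 4] that(2) by (simp add: rot_fan del: One_nat_def)
    then show ?thesis using that 3 4 by auto
  qed
  \<comment> \<open>The induction counts bigons backwards from the last one, following the
    rotation.\<close>
  have descend: "dart (n - 1 - j) 2 \<in> ?O" if "j < n" for j
    using that
  proof (induction j)
    case 0
    then show ?case
      by (simp, intro triangulation_orbit triangulation_fan assms) (simp add: fan_dart_iff)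
  next
    case (Suc j)
    then have "dart (n - 1 - j) 1 \<in> ?O"
      by (intro cycle[of "n - 1 - j" 1]) simp_all
    then have "rot (fan n) (dart (n - 1 - j) 1) \<in> ?O" by (rule orbit.step)
    moreover have "rot (fan n) (dart (n - 1 - j) 1) = dart (n - 1 - Suc j) 2"
      using Suc.prems by (subst rot_fan) auto
    ultimately show ?case by simp
  qed
  have seconds: "dart i 2 \<in> ?O" if "i < n" for i
  proof -
    have "n - 1 - (n - 1 - i) = i" "n - 1 - i < n" using that by arith+
    then show ?thesis using descend[of "n - 1 - i"] by simp
  qed
  show "?S \<subseteq> ?O"
  proof
    fix y assume "y \<in> ?S"
    then obtain i k where "y = dart i k" "i < n" "k \<in> {1, 2, 3, 4}" by auto
    then show "y \<in> ?O" using cycle[OF seconds] by simp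
  qed
qed

lemma orbit_fan_leaf:
  assumes "i < n"
  shows "orbit (rot (fan n)) (dart i 5) = {dart i 5}"
  by (simp add: orbit_eq_singleton_iff rot_fan[OF assms])

lemma card_fan_north: "card ((\<lambda>i. dart i 0) ` {..<n}) = n"
  by (subst card_image) (auto simp: inj_on_def dart_eq_iff)

lemma card_fan_south: "card ((\<lambda>(i, k). dart i k) ` ({..<n} \<times> {1, 2, 3, 4})) = 4 * n"
  by (subst card_image) (auto simp: inj_on_def dart_eq_iff card_cartesian_product)

lemma orbit_fan_south':
  assumes "1 \<le> n" "i < n" "k \<in> {1, 2, 3, 4}"
  shows "orbit (rot (fan n)) (dart i k) = (\<lambda>(i, k). dart i k) ` ({..<n} \<times> {1, 2, 3, 4})"
proof -
  have "dart i k \<in> orbit (rot (fan n)) (dart (n - 1) 2)"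
    unfolding orbit_fan_south[OF assms(1)] using assms by blast
  from triangulation_orbit_eq[OF triangulation_fan _ this] show ?thesis
    using assms orbit_fan_south by (simp add: fan_dart_iff)
qed

section \<open>The three moves that yield the recurrences\<close>

text \<open>The bubble is made on an edge \<open>NS\<close>, whose end points have degrees
  \<open>n\<close> and \<open>4 * n\<close>.\<close>

lemma fan_bubble_north:
  assumes "1 \<le> n"
  obtains T' where "bubble (fan n) T'" "\<And>v. v \<in> vertices T' \<Longrightarrow> 1 \<le> card v"
    "\<And>h :: nat \<Rightarrow> complex. (\<Sum>v\<in>vertices T'. h (card v)) + h n + h (4 * n) =
       (\<Sum>v\<in>vertices (fan n). h (card v)) + h (n + 2) + h (4 * n + 2) + h 2"
proof -
  have d: "dart 0 0 \<in> darts (fan n)" using assms by (simp add: fan_dart_iff)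
  have "opp (fan n) (dart 0 0) = dart (n - 1) 2"
    using assms by (simp add: opp_fan)
  then have y: "orbit (rot (fan n)) (opp (fan n) (dart 0 0)) =
      (\<lambda>(i, k). dart i k) ` ({..<n} \<times> {1, 2, 3, 4})"
    using orbit_fan_south[OF assms] by simp
  have "(\<lambda>i. dart i 0) ` {..<n} \<noteq> (\<lambda>(i, k). dart i k) ` ({..<n} \<times> {1, 2, 3, 4})"
  proof -
    have "dart 0 0 \<in> (\<lambda>i. dart i 0) ` {..<n}" using assms by auto
    moreover have "dart 0 0 \<notin> (\<lambda>(i, k). dart i k) ` ({..<n} \<times> {1, 2, 3, 4})"
      by (auto simp: dart_eq_iff)
    ultimately show ?thesis by blast
  qed
  from bubble_vertices[OF triangulation_fan[OF assms] d orbit_fan_north[OF assms, symmetric] y[symmetric] this] that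
  show thesis unfolding card_fan_north card_fan_south by metis
qed

text \<open>The bubble is made on the edge from \<open>S\<close> to a leaf. It shares the degree
  \<open>4 * n\<close> with the bubble on \<open>NS\<close>, so that comparing the two cancels the
  terms for \<open>S\<close>.\<close>

lemma fan_bubble_leaf:
  assumes "1 \<le> n"
  obtains T' where "bubble (fan n) T'" "\<And>v. v \<in> vertices T' \<Longrightarrow> 1 \<le> card v"
    "\<And>h :: nat \<Rightarrow> complex. (\<Sum>v\<in>vertices T'. h (card v)) + h 1 + h (4 * n) =
       (\<Sum>v\<in>vertices (fan n). h (card v)) + h 3 + h (4 * n + 2) + h 2"
proof -
  have d: "dart 0 5 \<in> darts (fan n)" using assms by (simp add: fan_dart_iff)
  have "opp (fan n) (dart 0 5) = dart 0 4"
    using assms by (simp add: opp_fan)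
  then have y: "orbit (rot (fan n)) (opp (fan n) (dart 0 5)) =
      (\<lambda>(i, k). dart i k) ` ({..<n} \<times> {1, 2, 3, 4})"
    using orbit_fan_south'[OF assms, of 0 4] assms by simp
  have x: "orbit (rot (fan n)) (dart 0 5) = {dart 0 5}"
    using assms by (intro orbit_fan_leaf) simp
  have "dart 0 5 \<notin> (\<lambda>(i, k). dart i k) ` ({..<n} \<times> {1, 2, 3, 4})"
    by (auto simp: dart_eq_iff)
  then have "{dart 0 5} \<noteq> (\<lambda>(i, k). dart i k) ` ({..<n} \<times> {1, 2, 3, 4})"
    by blast
  moreover have "card {dart 0 5} + 2 = 3" "card {dart 0 5} = 1" by simp_all
  ultimately show thesis
    using bubble_vertices[OF triangulation_fan[OF assms] d x[symmetric] y[symmetric]] that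
    unfolding card_fan_south by metis
qed

text \<open>Both ends of the fused edge are \<open>S\<close>, which drops from degree 4 to 2, while
  \<open>N\<close> and the leaf rise from 1 to 2.\<close>

lemma fan_1_fusion:
  obtains T' where "fusion (fan 1) T'" "\<And>v. v \<in> vertices T' \<Longrightarrow> 1 \<le> card v"
    "\<And>h :: nat \<Rightarrow> complex. (\<Sum>v\<in>vertices T'. h (card v)) = 3 * h 2"
    "\<And>h :: nat \<Rightarrow> complex. (\<Sum>v\<in>vertices (fan 1). h (card v)) = 2 * h 1 + h 4"
proof -
  let ?T = "fan 1"
  have dart0: "dart 0 k = k" for k by (simp add: dart_def)
  note nxt = nxt_fan[OF zero_less_one, unfolded dart0]
  note opp = opp_fan[OF zero_less_one, unfolded dart0]
  \<comment> \<open>This is the fusion at \<open>d = 1\<close>, one side of the loop at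
    \<open>S\<close>; the other side is 3.\<close>
  define T' where "T' = ?T\<lparr>nxt := (nxt ?T)(1 := 0, 0 := 4, 4 := 1, 3 := 5, 5 := 2, 2 := 3)\<rparr>"
  have D: "darts ?T = {0, 1, 2, 3, 4, 5}"
    by (auto simp: fan_def)
  have fus: "fusion ?T T'"
    unfolding fusion_def T'_def
    by (rule bexI[of _ 1]) (simp_all add: D nxt opp dart0 del: One_nat_def)
  have rot: "rot T' 0 = 3" "rot T' 3 = 0" "rot T' 1 = 5" "rot T' 5 = 1" "rot T' 2 = 4" "rot T' 4 = 2"
    by (simp_all add: rot_def T'_def opp dart0 del: One_nat_def)
  have "darts T' = {0, 1, 2, 3, 4, 5}"
    by (simp add: T'_def D del: One_nat_def)
  then have V': "vertices T' = {{0, 3}, {1, 5}, {2, 4}}"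
    using rot by (auto simp: vertices_def orbit_transposed_pair insert_commute simp del: One_nat_def)
  have "(\<lambda>(i, k). dart i k) ` ({..<1} \<times> {1, 2, 3, 4}) = {1, 2, 3, 4}"
    by (auto simp: dart0 image_iff)
  then have south: "orbit (rot ?T) k = {1, 2, 3, 4}" if "k \<in> {1, 2, 3, 4}" for k
    using orbit_fan_south'[of 1 0 k] that by (simp add: dart0 del: One_nat_def)
  have "orbit (rot ?T) 0 = {0}" "orbit (rot ?T) 5 = {5}"
    using orbit_fan_north[of 1] orbit_fan_leaf[of 0 1] by (simp_all add: dart0 lessThan_Suc)
  then have V: "vertices ?T = {{0}, {1, 2, 3, 4}, {5}}"
    using south[of 1] south[of 2] south[of 3] south[of 4]
    by (auto simp: vertices_def D simp del: One_nat_def)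
  show thesis
  proof
    show "fusion ?T T'" by fact
    show "1 \<le> card v" if "v \<in> vertices T'" for v
      using that by (auto simp: V')
    \<comment> \<open>Distinctness makes the sum have three separate terms.\<close>
    have ne': "{0, 3} \<noteq> {1::nat, 5}" "{0, 3} \<noteq> {2::nat, 4}" "{1, 5} \<noteq> {2::nat, 4}"
      by (auto simp: set_eq_iff)
    show "(\<Sum>v\<in>vertices T'. h (card v)) = 3 * h 2" for h :: "nat \<Rightarrow> complex"
      unfolding V' using ne' by (simp add: numeral_2_eq_2)
    have "0 \<notin> {1::nat, 2, 3, 4}" "0 \<notin> {5::nat}" "1 \<notin> {5::nat}"
      by simp_all
    then have ne: "{0} \<noteq> {1::nat, 2, 3, 4}" "{0} \<noteq> {5::nat}" "{1, 2, 3, 4} \<noteq> {5::nat}"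
      by (metis insertI1)+
    show "(\<Sum>v\<in>vertices ?T. h (card v)) = 2 * h 1 + h 4" for h :: "nat \<Rightarrow> complex"
      unfolding V using ne by (simp add: eval_nat_numeral)
  qed
qed

section \<open>Evaluating the invariant vertex sums on the fans\<close>

theorem mainTheorem8:
  fixes smul :: "complex \<Rightarrow> 'a::{real_normed_algebra_1, banach, comm_ring_1} \<Rightarrow> 'a"
    and \<phi> :: "nat \<Rightarrow> 'a"
    and K :: nat
    and f :: "nat \<Rightarrow> nat \<Rightarrow> complex"
  assumes "operator_algebra smul \<phi> K"
    and "exp_invariant smul \<phi> K f"
    and "invariant_perturbation smul \<phi> K f"
  shows "\<forall>\<alpha>\<le>K. \<exists>A::complex. \<forall>n\<ge>1. f \<alpha> n = A * (of_nat n - 6)"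
proof (intro allI impI)
  interpret operator_algebra smul \<phi> K by fact
  fix \<alpha> assume "\<alpha> \<le> K"
  have inv: "(\<Sum>v\<in>vertices T'. f \<alpha> (card v)) = (\<Sum>v\<in>vertices (fan n). f \<alpha> (card v))"
    if "1 \<le> n" "fusion (fan n) T' \<or> bubble (fan n) T'" "\<And>v. v \<in> vertices T' \<Longrightarrow> 1 \<le> card v" for n T'
    using vertex_sum_invariant[OF assms(3) triangulation_fan[OF that(1)] that(2) _ \<open>\<alpha> \<le> K\<close>]
      that(3) card_vertex_pos[OF triangulation_fan[OF that(1)]] by blast
  show "\<exists>A::complex. \<forall>n\<ge>1. f \<alpha> n = A * (of_nat n - 6)"
  \<comment> \<open>With \<open>inv\<close>, the vertex sums cancel in both bubble identities and
    are equated in the fusion case, which leaves the three equations for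
    \<open>f \<alpha>\<close>.\<close>
  proof (rule deficit_form)
    fix n :: nat assume n: "1 \<le> n"
    obtain T' where "bubble (fan n) T'" "\<And>v. v \<in> vertices T' \<Longrightarrow> 1 \<le> card v"
      "(\<Sum>v\<in>vertices T'. f \<alpha> (card v)) + f \<alpha> n + f \<alpha> (4 * n) =
       (\<Sum>v\<in>vertices (fan n). f \<alpha> (card v)) + f \<alpha> (n + 2) + f \<alpha> (4 * n + 2) + f \<alpha> 2"
      using fan_bubble_north[OF n] by metis
    then show "f \<alpha> n + f \<alpha> (4 * n) = f \<alpha> (n + 2) + f \<alpha> (4 * n + 2) + f \<alpha> 2"
      using inv[OF n] by (simp add: add.assoc)
    obtain T' where "bubble (fan n) T'" "\<And>v. v \<in> vertices T' \<Longrightarrow> 1 \<le> card v"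
      "(\<Sum>v\<in>vertices T'. f \<alpha> (card v)) + f \<alpha> 1 + f \<alpha> (4 * n) =
       (\<Sum>v\<in>vertices (fan n). f \<alpha> (card v)) + f \<alpha> 3 + f \<alpha> (4 * n + 2) + f \<alpha> 2"
      using fan_bubble_leaf[OF n] by metis
    then show "f \<alpha> 1 + f \<alpha> (4 * n) = f \<alpha> 3 + f \<alpha> (4 * n + 2) + f \<alpha> 2"
      using inv[OF n] by (simp add: add.assoc)
  next
    obtain T' where "fusion (fan 1) T'" "\<And>v. v \<in> vertices T' \<Longrightarrow> 1 \<le> card v"
      "(\<Sum>v\<in>vertices T'. f \<alpha> (card v)) = 3 * f \<alpha> 2"
      "(\<Sum>v\<in>vertices (fan 1). f \<alpha> (card v)) = 2 * f \<alpha> 1 + f \<alpha> 4"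
      using fan_1_fusion by metis
    then show "2 * f \<alpha> 1 + f \<alpha> 4 = 3 * f \<alpha> 2"
      using inv[OF order_refl, of T'] by simp
  qed
qed

end
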